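(* Let $\mathcal V_{W\dot W}$ be a genop, and let $p(s),p_1(s),q(s),a(s)$ denote polynomials over $\mathbb F$. 1. If $p(s)=p_1(s)q(s)$, then $p(\mathcal V_{W\dot W})=p_1(\mathcal V_{W\dot W})*q(\mathcal V_{W\dot W})$. 2. If $p(s)=p_1(s)q(s)+a(s)$, then $p(\mathcal V_{W\dot W})=\bigl(p_1(\mathcal V_{W\dot W})*q(\mathcal V_{W\dot W})\bigr)+_{\dot w}a(\mathcal V_{W\dot W})$. 3. Up to a nonzero scalar multiplying factor, there is a unique polynomial of minimum degree ($\ge 1$) which annihilates $\mathcal V_{W\dot W}$.
   Context: Fix a field $\mathbb F$; all index sets are finite. A vector on $X$ is a function $X\to\mathbb F$. $W,\dot W$ are disjoint sets that are copies of each other (in bijection); subscripts such as $(\mathcal V_{W\dot W})_{WW_1}$ denote relabelling of index sets along bijections. A genaut $\mathcal V_{W\dot W}$ is a linear subspace of vectors $(f_W,g_{\dot W})$ on $W\uplus\dot W$. $\mathcal V_{XY}\circ X:=\{f_X:(f_X,g_Y)\in\mathcal V_{XY}\text{ for some }g_Y\}$, $\mathcal V_{XY}\times X:=\{f_X:(f_X,0_Y)\in\mathcal V_{XY}\}$, $\mathcal V_{XY}\leftrightarrow\mathcal V_{YZ}:=\{(f_X,h_Z):\exists g_Y,(f_X,g_Y)\in\mathcal V_{XY},(g_Y,h_Z)\in\mathcal V_{YZ}\}$. A genaut is a genop if $\mathcal V_{W\dot W}\circ W\supseteq(\mathcal V_{W\dot W}\circ\dot W)_W$ and $\mathcal V_{W\dot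 W}\times W\supseteq(\mathcal V_{W\dot W}\times\dot W)_W$. Operations on genauts: - $\mathcal V^1_{W\dot W}+_{\dot w}\mathcal V^2_{W\dot W}:=\{(f_W,g^1_{\dot W}+g^2_{\dot W}):(f_W,g^i_{\dot W})\in\mathcal V^i_{W\dot W},\ i=1,2\}$. - $\lambda^{\dot w}\mathcal V_{W\dot W}:=\{(f_W,\lambda g_{\dot W}):(f_W,g_{\dot W})\in\mathcal V_{W\dot W}\}+(0_W\oplus\mathcal V_{W\dot W}\times\dot W)$ for $\lambda\in\mathbb F$. - $\mathcal V^1_{W\dot W}*\mathcal V^2_{W\dot W}:=(\mathcal V^1_{W\dot W})_{WW_1}\leftrightarrow(\mathcal V^2_{W\dot W})_{W_1\dot W}$, with $W_1$ a disjoint dummy copy of $W$. - $\mathcal V_{W\dot W}^{(0)}:=I_{W\dot W}+_{\dot w}[\mathcal V_{W\dot W}\circ W\oplus\mathcal V_{W\dot W}\times\dot W]$, where $I_{W\dot W}=\{(f_W,f_{\dot W})\}$ ($f_{\dot W}$ the copy of $f_W$); $\mathcal V_{W\dot W}^{(1)}:=\mathcal V_{W\dot W}$; $\mathcal V^{(k)}_{W\dot W}:=\mathcal V^{(k-1)}_{W\dot W}*\mathcal V_{W\dot W}$ for $k\ge2$. - For $p(s)=\sum_{i=0}^n\alpha_is^i$: $p(\mathcal V_{W\dot W}):=\alpha_0^{\dot w}\mathcal V^{(0)}_{W\dot W}+_{\dot w}\alpha_1^{\dot w}\mathcal V^{(1)}_{W\dot W}+_{\dot w}\cdots+_{\dot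 w}\alpha_n^{\dot w}\mathcal V^{(n)}_{W\dot W}$. A space on $W\uplus\dot W$ is decoupled if it has the form $\mathcal V^1_W\oplus\mathcal V^2_{\dot W}$. $p(s)$ annihilates $\mathcal V_{W\dot W}$ iff $p(\mathcal V_{W\dot W})$ is decoupled.
   Formalization: Part 3 with degree ≥ 1 is proved when V∘W ≠ (V×Ẇ)_W; if they are equal, every polynomial annihilates V (e.g. s and s−1), so uniqueness fails. For every genop, the minimum-degree nonzero annihilating polynomial is proved to exist and be unique up to a nonzero scalar. *)

theory Defs
  imports
    "HOL-Library.Function_Algebras"
    "HOL-Library.Product_Plus"
    "HOL-Library.Set_Algebras"
    "HOL-Computational_Algebra.Polynomial"
begin

text \<open>
  A vector on \<open>X\<close> is represented by a function that vanishes outside \<open>X\<close>; this gives a bijection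
  with the functions from \<open>X\<close> to the field and makes zero, sum and scaling the pointwise ones.
  The set \<open>X\<close> may be empty.
\<close>

definition vecs :: "'w set \<Rightarrow> ('w \<Rightarrow> 'a::field) set" where
  "vecs X = {f. \<forall>x. x \<notin> X \<longrightarrow> f x = 0}"

definition vscale :: "'a::field \<Rightarrow> ('w \<Rightarrow> 'a) \<Rightarrow> ('w \<Rightarrow> 'a)" where
  "vscale c f = (\<lambda>x. c * f x)"

definition pscale :: "'a::field \<Rightarrow> ('w \<Rightarrow> 'a) \<times> ('w \<Rightarrow> 'a) \<Rightarrow> ('w \<Rightarrow> 'a) \<times> ('w \<Rightarrow> 'a)" where
  "pscale c v = (vscale c (fst v), vscale c (snd v))"

global_interpretation fvec: vector_space vscale
  by unfold_locales (auto simp: vscale_def fun_eq_iff algebra_simps)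

global_interpretation pvec: vector_space pscale
  by unfold_locales (auto simp: pscale_def fvec.scale_right_distrib fvec.scale_left_distrib)

text \<open>
  A vector on the disjoint union of \<open>W\<close> and its copy is a pair \<open>(f, g)\<close> of vectors on \<open>W\<close>: the first
  component is the part on \<open>W\<close>, the second one the part on the copy, relabelled to \<open>W\<close>. All
  relabellings along the bijection between the copies thereby become identities, and a space
  \<open>A \<oplus> B\<close> is the Cartesian product \<open>A \<times> B\<close>. The restriction of \<open>V\<close> to \<open>W\<close> is
  \<^term>\<open>Domain V\<close>, its restriction to the copy is \<^term>\<open>Range V\<close>, and matched composition of
  \<open>V1\<close> with \<open>V2\<close> is \<^term>\<open>V1 O V2\<close>.
\<close>

type_synonym ('w, 'a) pairs = "(('w \<Rightarrow> 'a) \<times> ('w \<Rightarrow> 'a)) set"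

definition contract :: "('w, 'a::field) pairs \<Rightarrow> ('w \<Rightarrow> 'a) set" where
  "contract V = {f. (f, 0) \<in> V}"

definition contract_dot :: "('w, 'a::field) pairs \<Rightarrow> ('w \<Rightarrow> 'a) set" where
  "contract_dot V = {g. (0, g) \<in> V}"

definition genaut :: "'w set \<Rightarrow> ('w, 'a::field) pairs \<Rightarrow> bool" where
  "genaut W V \<longleftrightarrow> V \<subseteq> vecs W \<times> vecs W \<and> pvec.subspace V"

definition genop :: "'w set \<Rightarrow> ('w, 'a::field) pairs \<Rightarrow> bool" where
  "genop W V \<longleftrightarrow> genaut W V \<and> Range V \<subseteq> Domain V \<and> contract_dot V \<subseteq> contract V"

definition gadd :: "('w, 'a::field) pairs \<Rightarrow> ('w, 'a) pairs \<Rightarrow> ('w, 'a) pairs"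
    (infixl "+\<^sub>w" 65) where
  "V1 +\<^sub>w V2 = {(f, g1 + g2) | f g1 g2. (f, g1) \<in> V1 \<and> (f, g2) \<in> V2}"

definition gscale :: "'a::field \<Rightarrow> ('w, 'a) pairs \<Rightarrow> ('w, 'a) pairs" where
  "gscale c V = {(f, vscale c g) | f g. (f, g) \<in> V} + {0} \<times> contract_dot V"

abbreviation gmult :: "('w, 'a::field) pairs \<Rightarrow> ('w, 'a) pairs \<Rightarrow> ('w, 'a) pairs"
    (infixl "*\<^sub>w" 70) where
  "V1 *\<^sub>w V2 \<equiv> V1 O V2"

fun gpow :: "'w set \<Rightarrow> ('w, 'a::field) pairs \<Rightarrow> nat \<Rightarrow> ('w, 'a) pairs" where
  "gpow W V 0 = Id_on (vecs W) +\<^sub>w (Domain V \<times> contract_dot V)"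
| "gpow W V (Suc 0) = V"
| "gpow W V (Suc (Suc k)) = gpow W V (Suc k) *\<^sub>w V"

primrec gsum :: "(nat \<Rightarrow> ('w, 'a::field) pairs) \<Rightarrow> nat \<Rightarrow> ('w, 'a) pairs" where
  "gsum A 0 = A 0"
| "gsum A (Suc n) = gsum A n +\<^sub>w A (Suc n)"

text \<open>
  The sum stops at the degree of \<open>p\<close>, and the zero polynomial has the single term of index 0.
  For a genop, further terms with coefficient zero would not change the result.
\<close>

definition gpoly :: "'w set \<Rightarrow> ('w, 'a::field) pairs \<Rightarrow> 'a poly \<Rightarrow> ('w, 'a) pairs" where
  "gpoly W V p = gsum (\<lambda>i. gscale (coeff p i) (gpow W V i)) (degree p)"

definition decoupled :: "'w set \<Rightarrow> ('w, 'a::field) pairs \<Rightarrow> bool" where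
  "decoupled W S \<longleftrightarrow>
     (\<exists>A B. A \<subseteq> vecs W \<and> fvec.subspace A \<and> B \<subseteq> vecs W \<and> fvec.subspace B \<and> S = A \<times> B)"

text \<open>The zero polynomial annihilates every genop, so minimality has to exclude it.\<close>

definition annihilates :: "'w set \<Rightarrow> ('w, 'a::field) pairs \<Rightarrow> 'a poly \<Rightarrow> bool" where
  "annihilates W V p \<longleftrightarrow> decoupled W (gpoly W V p)"

end

theory Submission imports Defs begin

text \<open>
  A genop \<open>V\<close> is a linear operator in disguise. Put \<open>D = Domain V\<close> and \<open>N = contract_dot V\<close>. Sending
  \<open>f \<in> D\<close> to the coset of all \<open>g\<close> with \<open>(f, g) \<in> V\<close> is a linear map from \<open>D\<close> to the vectors modulo
  \<open>N\<close>. The two genop conditions say that its values lie in \<open>D / N\<close> and that it vanishes on \<open>N\<close>, so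
  it induces an endomorphism \<open>T\<close> of \<open>D / N\<close>. The operations on genauts are designed so that
  \<^term>\<open>gpoly W V p\<close> is the relation on \<open>D\<close> that \<open>p(T)\<close> induces, and this relation is decoupled
  exactly if \<open>p(T) = 0\<close>. The product and division rules thus become the facts that \<open>p \<mapsto> p(T)\<close> is
  additive and multiplicative, and the last part is the theory of the minimal polynomial of \<open>T\<close>.

  The quotient can be avoided: there is a linear operator \<open>L\<close> on all vectors with \<open>(f, L f) \<in> V\<close> for
  all \<open>f \<in> D\<close>, and it maps both \<open>D\<close> and \<open>N\<close> into themselves (\<open>genop_eq_coset_graph\<close>). Then \<open>V\<close>
  consists of the pairs \<open>(f, L f + n)\<close> with \<open>f \<in> D\<close> and \<open>n \<in> N\<close>, and \<^term>\<open>gpoly W V p\<close> consists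
  of the pairs \<open>(f, p(L) f + n)\<close> (\<open>gpoly_coset_graph\<close>); this is decoupled iff \<open>p(L)\<close> maps \<open>D\<close> into
  \<open>N\<close> (\<open>decoupled_coset_graph\<close>).

  A nonzero annihilator exists because \<open>D\<close> has finite dimension: each vector of a finite basis of \<open>D\<close>
  is killed by \<open>p(L)\<close> for some \<open>p \<noteq> 0\<close>, and the product of these polynomials kills \<open>D\<close>
  (\<open>ex_annihilator_on_subspace\<close>). Uniqueness only uses that the annihilators form a linear subspace
  of the polynomials (\<open>min_degree_unique_up_to_scalar\<close>). A nonzero constant annihilates only if
  \<open>D = N\<close>, so for \<open>D \<noteq> N\<close> the nonzero annihilators are exactly those of degree at least 1.
\<close>

section \<open>Relations induced by maps into a quotient\<close>

text \<open>
  This is the map \<open>f \<mapsto> F f + N\<close> from \<open>D\<close> to cosets of \<open>N\<close>, viewed as a relation between vectors.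
  The operator \<open>F\<close> matters only modulo \<open>N\<close>; keeping it total avoids a quotient type.
\<close>

definition coset_graph :: "('w \<Rightarrow> 'a::field) set \<Rightarrow> ('w \<Rightarrow> 'a) set \<Rightarrow>
    (('w \<Rightarrow> 'a) \<Rightarrow> 'w \<Rightarrow> 'a) \<Rightarrow> ('w, 'a) pairs" where
  "coset_graph D N F = {(f, F f + n) | f n. f \<in> D \<and> n \<in> N}"

lemma mem_coset_graph: "(f, g) \<in> coset_graph D N F \<longleftrightarrow> f \<in> D \<and> (\<exists>n\<in>N. g = F f + n)"
  by (auto simp: coset_graph_def)

lemma mem_coset_graph_iff_diff:
  fixes f g :: "'w \<Rightarrow> 'a::field"
  shows "(f, g) \<in> coset_graph D N F \<longleftrightarrow> f \<in> D \<and> g - F f \<in> N"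
proof -
  have "(\<exists>n\<in>N. g = F f + n) \<longleftrightarrow> g - F f \<in> N"
    by (metis add_diff_cancel_left' diff_add_cancel)
  then show ?thesis by (simp add: mem_coset_graph)
qed

lemma contract_dot_coset_graph:
  assumes "0 \<in> D" "F 0 = 0"
  shows "contract_dot (coset_graph D N F) = N"
  using assms by (auto simp: contract_dot_def mem_coset_graph)

lemma gadd_coset_graph:
  fixes F G :: "('w \<Rightarrow> 'a::field) \<Rightarrow> ('w \<Rightarrow> 'a)"
  assumes "fvec.subspace N"
  shows "coset_graph D N F +\<^sub>w coset_graph D N G = coset_graph D N (\<lambda>f. F f + G f)"
proof (intro set_eqI iffI; clarify)
  fix f g assume "(f, g) \<in> coset_graph D N F +\<^sub>w coset_graph D N G"
  then obtain m n where "f \<in> D" "m \<in> N" "n \<in> N" "g = (F f + m) + (G f + n)"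
    by (auto simp: gadd_def mem_coset_graph)
  moreover have "m + n \<in> N" using calculation assms by (simp add: fvec.subspace_add)
  ultimately show "(f, g) \<in> coset_graph D N (\<lambda>f. F f + G f)"
    unfolding mem_coset_graph by (intro conjI bexI[of _ "m + n"]) (simp_all add: algebra_simps)
next
  fix f g assume "(f, g) \<in> coset_graph D N (\<lambda>f. F f + G f)"
  then obtain n where "f \<in> D" "n \<in> N" "g = F f + (G f + n)"
    by (auto simp: mem_coset_graph algebra_simps)
  moreover have "(f, F f) \<in> coset_graph D N F" "(f, G f + n) \<in> coset_graph D N G"
    using calculation assms by (simp_all add: mem_coset_graph_iff_diff fvec.subspace_0)
  ultimately show "(f, g) \<in> coset_graph D N F +\<^sub>w coset_graph D N G"
    unfolding gadd_def by blast
qed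

text \<open>
  Scaling by \<open>c \<noteq> 0\<close> maps \<open>N\<close> onto itself, but scaling by 0 shrinks it to the zero space. The summand
  \<^term>\<open>{0} \<times> contract_dot V\<close> in \<^const>\<open>gscale\<close> restores \<open>N\<close>, so the formula holds for every \<open>c\<close>.
\<close>

lemma gscale_coset_graph:
  fixes F :: "('w \<Rightarrow> 'a::field) \<Rightarrow> ('w \<Rightarrow> 'a)"
  assumes N: "fvec.subspace N" and "0 \<in> D" "F 0 = 0"
  shows "gscale c (coset_graph D N F) = coset_graph D N (\<lambda>f. vscale c (F f))"
proof (intro set_eqI iffI; clarify)
  fix f g assume "(f, g) \<in> gscale c (coset_graph D N F)"
  then obtain m n where "f \<in> D" "m \<in> N" "n \<in> N" "g = vscale c (F f + m) + n"
    by (auto simp: gscale_def contract_dot_coset_graph assms set_plus_def mem_coset_graph)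
  moreover have "vscale c m + n \<in> N"
    using calculation N by (simp add: fvec.subspace_add fvec.subspace_scale)
  ultimately show "(f, g) \<in> coset_graph D N (\<lambda>f. vscale c (F f))"
    unfolding mem_coset_graph
    by (intro conjI bexI[of _ "vscale c m + n"])
      (simp_all add: algebra_simps)
next
  fix f g assume "(f, g) \<in> coset_graph D N (\<lambda>f. vscale c (F f))"
  then obtain n where "f \<in> D" "n \<in> N" and g: "g = vscale c (F f) + n"
    by (auto simp: mem_coset_graph)
  moreover have "(f, F f) \<in> coset_graph D N F"
    using calculation N by (simp add: mem_coset_graph_iff_diff fvec.subspace_0)
  ultimately have "(f, vscale c (F f)) + (0, n) \<in> gscale c (coset_graph D N F)"
    unfolding gscale_def contract_dot_coset_graph[of D F N, OF assms(2,3)]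
    by (intro set_plus_intro) auto
  then show "(f, g) \<in> gscale c (coset_graph D N F)" by (simp add: g)
qed

text \<open>
  A pair in the composition has the form \<open>(f, G (F f + m) + n)\<close>. Invariance of \<open>N\<close> under \<open>G\<close> absorbs
  the perturbation \<open>G m\<close>, and \<open>N \<subseteq> D\<close> with invariance of \<open>D\<close> under \<open>F\<close> lets the two maps be chained.
\<close>

lemma relcomp_coset_graph:
  fixes F G :: "('w \<Rightarrow> 'a::field) \<Rightarrow> ('w \<Rightarrow> 'a)"
  assumes N: "fvec.subspace N" and D: "fvec.subspace D" and "N \<subseteq> D"
    and F: "F ` D \<subseteq> D" and G: "G ` N \<subseteq> N" and G_add: "\<And>x y. G (x + y) = G x + G y"
  shows "coset_graph D N F O coset_graph D N G = coset_graph D N (\<lambda>f. G (F f))"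
proof (intro set_eqI iffI; clarify)
  fix f g h assume "(f, g) \<in> coset_graph D N F" "(g, h) \<in> coset_graph D N G"
  then obtain m n where "f \<in> D" "m \<in> N" "n \<in> N" "h = G (F f + m) + n"
    by (auto simp: mem_coset_graph)
  moreover have "G m + n \<in> N" using calculation N G by (auto intro: fvec.subspace_add)
  ultimately show "(f, h) \<in> coset_graph D N (\<lambda>f. G (F f))"
    unfolding mem_coset_graph
    by (intro conjI bexI[of _ "G m + n"]) (simp_all add: G_add algebra_simps)
next
  fix f h assume "(f, h) \<in> coset_graph D N (\<lambda>f. G (F f))"
  then have "(f, F f) \<in> coset_graph D N F" "(F f, h) \<in> coset_graph D N G"
    using F N by (auto simp: mem_coset_graph_iff_diff fvec.subspace_0)
  then show "(f, h) \<in> coset_graph D N F O coset_graph D N G" by blast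
qed

lemma gsum_coset_graph:
  assumes "fvec.subspace N"
  shows "gsum (\<lambda>i. coset_graph D N (F i)) n = coset_graph D N (\<lambda>f. \<Sum>i\<le>n. F i f)"
  by (induction n) (simp_all add: gadd_coset_graph assms del: plus_fun_apply)

text \<open>
  If the relation is a product, then the pairs \<open>(f, F f)\<close> and \<open>(0, 0)\<close> in it also give \<open>(0, F f)\<close>,
  whence \<open>F f \<in> N\<close>. Conversely, if \<open>F\<close> maps \<open>D\<close> into \<open>N\<close>, then every
  coset \<open>F f + N\<close> with \<open>f \<in> D\<close> is \<open>N\<close> itself.
\<close>

lemma decoupled_coset_graph:
  fixes F :: "('w \<Rightarrow> 'a::field) \<Rightarrow> ('w \<Rightarrow> 'a)"
  assumes N: "fvec.subspace N" and D: "fvec.subspace D" and W: "N \<subseteq> vecs W" "D \<subseteq> vecs W"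
    and F0: "F 0 = 0"
  shows "decoupled W (coset_graph D N F) \<longleftrightarrow> F ` D \<subseteq> N"
proof
  assume "decoupled W (coset_graph D N F)"
  then obtain A B where S: "coset_graph D N F = A \<times> B" by (auto simp: decoupled_def)
  show "F ` D \<subseteq> N"
  proof clarify
    fix f assume "f \<in> D"
    then have "(f, F f) \<in> A \<times> B" "(0, 0) \<in> A \<times> B"
      unfolding S[symmetric] using N D F0
      by (simp_all add: mem_coset_graph_iff_diff fvec.subspace_0)
    then have "(0, F f) \<in> coset_graph D N F" unfolding S by blast
    then show "F f \<in> N" by (simp add: mem_coset_graph_iff_diff F0)
  qed
next
  assume F: "F ` D \<subseteq> N"
  have "f \<in> D \<Longrightarrow> g - F f \<in> N \<longleftrightarrow> g \<in> N" for f g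
    using fvec.subspace_add[OF N, of "g - F f" "F f"] fvec.subspace_diff[OF N, of g "F f"] F
    by (auto simp: image_subset_iff)
  then have "coset_graph D N F = D \<times> N" by (auto simp: mem_coset_graph_iff_diff)
  then show "decoupled W (coset_graph D N F)"
    unfolding decoupled_def using N D W by blast
qed

section \<open>Polynomials of a linear operator\<close>

definition poly_op :: "(('w \<Rightarrow> 'a::field) \<Rightarrow> ('w \<Rightarrow> 'a)) \<Rightarrow> 'a poly \<Rightarrow> ('w \<Rightarrow> 'a) \<Rightarrow> ('w \<Rightarrow> 'a)"
  where "poly_op L p f = (\<Sum>i\<le>degree p. vscale (coeff p i) ((L ^^ i) f))"

lemma poly_op_eq_sum:
  assumes "degree p \<le> n"
  shows "poly_op L p f = (\<Sum>i\<le>n. vscale (coeff p i) ((L ^^ i) f))"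
  unfolding poly_op_def using assms by (intro sum.mono_neutral_left) (auto simp: coeff_eq_0)

lemma poly_op_0 [simp]: "poly_op L 0 f = 0"
  by (simp add: poly_op_def)

lemma poly_op_const [simp]: "poly_op L [:c:] f = vscale c f"
  by (simp add: poly_op_def)

lemma poly_op_add: "poly_op L (p + q) f = poly_op L p f + poly_op L q f"
proof -
  let ?n = "max (degree p) (degree q)"
  show ?thesis
    by (simp add: poly_op_eq_sum[of _ ?n] degree_add_le fvec.scale_left_distrib sum.distrib)
qed

lemma poly_op_smult: "poly_op L (smult c p) f = vscale c (poly_op L p f)"
  by (simp add: poly_op_eq_sum[of _ "degree p"] degree_smult_le fvec.scale_sum_right)

lemma poly_op_diff: "poly_op L (p - q) f = poly_op L p f - poly_op L q f"
  using poly_op_add[of L "p - q" q f] by simp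

lemma poly_op_pCons: "poly_op L (pCons a p) f = vscale a f + poly_op L p (L f)"
proof -
  have "poly_op L (pCons a p) f
      = (\<Sum>i\<le>Suc (degree p). vscale (coeff (pCons a p) i) ((L ^^ i) f))"
    by (intro poly_op_eq_sum) (simp add: degree_pCons_le)
  then show ?thesis
    by (simp del: sum.atMost_Suc add: sum.atMost_Suc_shift poly_op_def funpow_swap1)
qed

lemma linear_funpow:
  fixes L :: "('w \<Rightarrow> 'a::field) \<Rightarrow> ('w \<Rightarrow> 'a)"
  assumes "Vector_Spaces.linear vscale vscale L"
  shows "Vector_Spaces.linear vscale vscale (L ^^ i)"
proof (induction i)
  case 0
  show ?case using fvec.linear_id by (simp add: id_def)
next
  case (Suc i)
  show ?case using Vector_Spaces.linear_compose[OF Suc assms] by (simp only: funpow.simps)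
qed

lemma linear_poly_op:
  fixes L :: "('w \<Rightarrow> 'a::field) \<Rightarrow> ('w \<Rightarrow> 'a)"
  assumes "Vector_Spaces.linear vscale vscale L"
  shows "Vector_Spaces.linear vscale vscale (poly_op L p)"
proof -
  interpret P: vector_space_pair "vscale :: 'a \<Rightarrow> ('w \<Rightarrow> 'a) \<Rightarrow> _" "vscale :: 'a \<Rightarrow> ('w \<Rightarrow> 'a) \<Rightarrow> _" ..
  have "Vector_Spaces.linear vscale vscale
      (\<lambda>f. \<Sum>i\<le>degree p. vscale (coeff p i) ((L ^^ i) f))"
    by (intro P.linear_compose_sum ballI P.linear_compose_scale_right linear_funpow assms)
  then show ?thesis by (simp add: poly_op_def[abs_def])
qed

text \<open>
  The factor \<open>p\<close> acts first, matching the order of relational composition. In the induction, linearity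
  of \<^term>\<open>poly_op L q\<close> distributes it over \<^term>\<open>vscale a f + poly_op L p (L f)\<close>.
\<close>

lemma poly_op_mult: "poly_op L (p * q) f = poly_op L q (poly_op L p f)"
  if "Vector_Spaces.linear vscale vscale L"
proof (induction p arbitrary: f)
  case 0
  interpret Q: Vector_Spaces.linear vscale vscale "poly_op L q" by (rule linear_poly_op[OF that])
  show ?case by (simp only: mult_zero_left poly_op_0 Q.zero)
next
  case (pCons a p)
  interpret Q: Vector_Spaces.linear vscale vscale "poly_op L q" by (rule linear_poly_op[OF that])
  show ?case
    by (simp add: poly_op_add poly_op_smult poly_op_pCons pCons.IH Q.add Q.scale
        del: plus_fun_apply)
qed

lemma poly_op_image_subset:
  assumes "fvec.subspace S" "L ` S \<subseteq> S"
  shows "poly_op L p ` S \<subseteq> S"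
proof clarify
  fix f assume f: "f \<in> S"
  have "(L ^^ i) f \<in> S" for i using f assms(2) by (induction i) auto
  then show "poly_op L p f \<in> S"
    unfolding poly_op_def using assms(1) by (intro fvec.subspace_sum fvec.subspace_scale)
qed

section \<open>Existence of an annihilating polynomial\<close>

lemma vecs_subset_span_indicators:
  fixes W :: "'w set"
  assumes "finite W"
  shows "vecs W \<subseteq> fvec.span ((\<lambda>w x. if x = w then 1 else 0 :: 'a::field) ` W)"
proof
  fix f :: "'w \<Rightarrow> 'a" assume "f \<in> vecs W"
  let ?e = "\<lambda>w x. if x = w then 1 else 0 :: 'a"
  have sum_apply: "sum G W x = (\<Sum>w\<in>W. G w x)" for G :: "'w \<Rightarrow> 'w \<Rightarrow> 'a" and x
    using assms by (induction W) simp_all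
  have "f x = (\<Sum>w\<in>W. vscale (f w) (?e w)) x" for x
    using \<open>f \<in> vecs W\<close> assms
    by (simp add: sum_apply vscale_def vecs_def if_distrib[of "(*) _"] cong: if_cong)
  then have "f = (\<Sum>w\<in>W. vscale (f w) (?e w))" by blast
  then show "f \<in> fvec.span (?e ` W)"
    by (metis (no_types, lifting) fvec.span_sum fvec.span_scale fvec.span_base imageI)
qed

lemma independent_vecs_card_le:
  assumes "finite W" "fvec.independent B" "B \<subseteq> vecs W"
  shows "finite B \<and> card B \<le> card W"
proof -
  let ?E = "(\<lambda>w x. if x = w then 1 else 0 :: 'b) ` W"
  have "finite B \<and> card B \<le> card ?E"
    using assms vecs_subset_span_indicators[OF assms(1)]
    by (intro fvec.independent_span_bound) auto
  then show ?thesis using card_image_le[OF assms(1)] order_trans by blast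
qed

text \<open>
  The family may contain repetitions, so it does not reduce at once to dependence of a set of vectors:
  two equal members give the relation \<open>g i - g j = 0\<close>, and otherwise the members form a set of
  \<^term>\<open>Suc (card W)\<close> vectors, too many to be independent.
\<close>

lemma ex_linear_relation:
  fixes g :: "nat \<Rightarrow> 'w \<Rightarrow> 'a::field"
  assumes W: "finite W" and g: "\<And>i. g i \<in> vecs W"
  shows "\<exists>c. (\<exists>i\<le>card W. c i \<noteq> 0) \<and> (\<Sum>i\<le>card W. vscale (c i) (g i)) = 0"
proof (cases "inj_on g {..card W}")
  case True
  have "card (g ` {..card W}) = Suc (card W)" by (simp add: card_image True)
  then have "\<not> card (g ` {..card W}) \<le> card W" by simp
  then have "fvec.dependent (g ` {..card W})"
    using independent_vecs_card_le[OF W, of "g ` {..card W}"] g by blast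
  then obtain u where "\<exists>v\<in>g ` {..card W}. u v \<noteq> 0"
    "(\<Sum>v\<in>g ` {..card W}. vscale (u v) v) = 0"
    by (auto simp: fvec.dependent_finite)
  then show ?thesis
    by (intro exI[of _ "\<lambda>i. u (g i)"]) (auto simp: sum.reindex[OF True])
next
  case False
  then obtain i j where ij: "i \<le> card W" "j \<le> card W" "i \<noteq> j" "g i = g j"
    by (auto simp: inj_on_def)
  let ?c = "\<lambda>k. (if k = i then 1 else 0) - (if k = j then 1 else 0 :: 'a)"
  have "(\<Sum>k\<le>card W. vscale (?c k) (g k)) = g i - g j"
    using ij(1,2)
    by (simp add: fvec.scale_left_diff_distrib sum_subtractf if_distrib[of "\<lambda>c. vscale c _"]
        cong: if_cong)
  then show ?thesis using ij by (intro exI[of _ ?c]) auto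
qed

text \<open>
  A linear relation among \<open>f, L f, L (L f), \<dots>\<close> is a polynomial of \<open>L\<close> that kills \<open>f\<close>.
\<close>

lemma ex_annihilator_of_vector:
  fixes L :: "('w \<Rightarrow> 'a::field) \<Rightarrow> ('w \<Rightarrow> 'a)"
  assumes W: "finite W" and orbit: "\<And>i. (L ^^ i) f \<in> vecs W"
  shows "\<exists>p. p \<noteq> 0 \<and> poly_op L p f = 0"
proof -
  obtain c k where c: "k \<le> card W" "c k \<noteq> 0"
    "(\<Sum>i\<le>card W. vscale (c i) ((L ^^ i) f)) = 0"
    using ex_linear_relation[OF W, of "\<lambda>i. (L ^^ i) f"] orbit by blast
  define p where "p = (\<Sum>i\<le>card W. monom (c i) i)"
  have coeff_p: "coeff p i = (if i \<le> card W then c i else 0)" for i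
    by (simp add: p_def coeff_sum)
  then have "degree p \<le> card W" by (intro degree_le) simp
  then have "poly_op L p f = 0" using c by (simp add: poly_op_eq_sum coeff_p)
  moreover have "p \<noteq> 0" using c coeff_p[of k] by auto
  ultimately show ?thesis by blast
qed

text \<open>
  Polynomials of \<open>L\<close> commute, so a product of polynomials kills every vector that one of its factors
  kills. Multiplying annihilators of the vectors of a finite basis therefore kills the whole span.
\<close>

lemma ex_annihilator_on_subspace:
  fixes L :: "('w \<Rightarrow> 'a::field) \<Rightarrow> ('w \<Rightarrow> 'a)"
  assumes W: "finite W" and L: "Vector_Spaces.linear vscale vscale L"
    and D: "D \<subseteq> vecs W" "L ` D \<subseteq> D"
  shows "\<exists>p. p \<noteq> 0 \<and> (\<forall>f\<in>D. poly_op L p f = 0)"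
proof -
  obtain B where B: "B \<subseteq> D" "fvec.independent B" "D \<subseteq> fvec.span B"
    by (rule fvec.basis_exists[of D])
  have "finite B" using independent_vecs_card_le[OF W B(2)] B(1) D(1) by blast
  have "\<exists>p. p \<noteq> 0 \<and> poly_op L p b = 0" if "b \<in> B" for b
  proof (rule ex_annihilator_of_vector[OF W])
    fix i
    have "(L ^^ i) b \<in> D" using that B(1) D(2) by (induction i) auto
    then show "(L ^^ i) b \<in> vecs W" using D(1) by blast
  qed
  then obtain P where P: "\<And>b. b \<in> B \<Longrightarrow> P b \<noteq> 0 \<and> poly_op L (P b) b = 0" by metis
  define p where "p = (\<Prod>b\<in>B. P b)"
  interpret p: Vector_Spaces.linear vscale vscale "poly_op L p" by (rule linear_poly_op[OF L])
  have "poly_op L p b = 0" if "b \<in> B" for b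
  proof -
    interpret R: Vector_Spaces.linear vscale vscale "poly_op L (prod P (B - {b}))"
      by (rule linear_poly_op[OF L])
    \<comment> \<open>The factor that kills \<open>b\<close> comes first because \<open>poly_op_mult\<close> applies the left factor first.\<close>
    have "p = P b * prod P (B - {b})"
      unfolding p_def by (rule prod.remove[OF \<open>finite B\<close> that])
    then show ?thesis using P[OF that] by (simp add: poly_op_mult[OF L] R.zero)
  qed
  then have "B \<subseteq> {f. poly_op L p f = 0}" by blast
  moreover have "fvec.subspace {f. poly_op L p f = 0}"
    by (simp add: fvec.subspace_def p.add p.scale)
  ultimately have "D \<subseteq> {f. poly_op L p f = 0}" using B(3) fvec.span_minimal by blast
  moreover have "p \<noteq> 0" using P \<open>finite B\<close> by (simp add: p_def)
  ultimately show ?thesis by blast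
qed

section \<open>Polynomials of minimum degree in a linear subspace\<close>

text \<open>
  Two nonzero members of least degree can be scaled to have the same leading coefficient. Their
  difference is a member of smaller degree, hence zero.
\<close>

lemma min_degree_unique_up_to_scalar:
  fixes I :: "'a::field poly set"
  assumes diff: "\<And>p q. p \<in> I \<Longrightarrow> q \<in> I \<Longrightarrow> p - q \<in> I"
    and smult: "\<And>c p. p \<in> I \<Longrightarrow> smult c p \<in> I"
    and ex: "\<exists>p\<in>I. p \<noteq> 0"
  shows "\<exists>p. is_arg_min degree (\<lambda>r. r \<noteq> 0 \<and> r \<in> I) p \<and>
    (\<forall>q. is_arg_min degree (\<lambda>r. r \<noteq> 0 \<and> r \<in> I) q \<longleftrightarrow> (\<exists>c. c \<noteq> 0 \<and> q = smult c p))"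
proof -
  let ?Min = "is_arg_min degree (\<lambda>r. r \<noteq> 0 \<and> r \<in> I)"
  obtain p where p: "?Min p"
    using ex arg_min_natI[of "\<lambda>r. r \<noteq> 0 \<and> r \<in> I" _ degree]
      arg_min_nat_le[of "\<lambda>r. r \<noteq> 0 \<and> r \<in> I" _ degree]
    by (auto simp: is_arg_min_def simp flip: not_le)
  have "\<exists>c. c \<noteq> 0 \<and> q = smult c p" if q: "?Min q" for q
  proof -
    have nz: "p \<noteq> 0" "q \<noteq> 0" and mem: "p \<in> I" "q \<in> I"
      using p q by (auto simp: is_arg_min_def)
    have deg: "degree q = degree p"
      using p q by (metis (no_types, lifting) is_arg_min_def linorder_neqE_nat)
    define c where "c = lead_coeff q / lead_coeff p"
    have "c \<noteq> 0" using nz by (simp add: c_def)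
    have "coeff (q - smult c p) i = 0" if "degree p \<le> i" for i
      using that nz deg by (cases "i = degree p") (auto simp: c_def coeff_eq_0)
    then have "q - smult c p = 0 \<or> degree (q - smult c p) < degree p"
      by (metis leading_coeff_0_iff not_le)
    moreover have "q - smult c p \<in> I" by (intro diff smult mem)
    ultimately have "q - smult c p = 0" using p by (auto simp: is_arg_min_def)
    then show ?thesis using \<open>c \<noteq> 0\<close> by auto
  qed
  moreover have "?Min (smult c p)" if "c \<noteq> 0" for c
    using p that smult by (auto simp: is_arg_min_def)
  ultimately show ?thesis using p by blast
qed

section \<open>Genops as operators modulo a subspace\<close>

text \<open>
  Choosing \<open>g\<close> with \<open>(b, g) \<in> V\<close> for the vectors \<open>b\<close> of a basis of the domain, and extending linearly,
  gives \<open>L\<close>. Two partners of the same \<open>f\<close> differ by an element of \<^term>\<open>contract_dot V\<close>, so \<open>V\<close> is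
  determined by \<open>L\<close> and these two subspaces. For \<open>n\<close> in \<^term>\<open>contract_dot V\<close>, the genop condition
  gives \<open>(n, 0) \<in> V\<close>; together with \<open>(n, L n) \<in> V\<close> this makes \<open>L n\<close> an element of
  \<^term>\<open>contract_dot V\<close> again.
\<close>

lemma genop_eq_coset_graph:
  fixes V :: "('w, 'a::field) pairs"
  assumes "genop W V"
  obtains L where "Vector_Spaces.linear vscale vscale L"
    "V = coset_graph (Domain V) (contract_dot V) L"
    "L ` Domain V \<subseteq> Domain V" "L ` contract_dot V \<subseteq> contract_dot V"
proof -
  interpret P: vector_space_pair "vscale :: 'a \<Rightarrow> ('w \<Rightarrow> 'a) \<Rightarrow> _" "vscale :: 'a \<Rightarrow> ('w \<Rightarrow> 'a) \<Rightarrow> _" ..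
  have V: "pvec.subspace V" "Range V \<subseteq> Domain V" "contract_dot V \<subseteq> contract V"
    using assms by (auto simp: genop_def genaut_def)
  obtain B where B: "B \<subseteq> Domain V" "fvec.independent B" "Domain V \<subseteq> fvec.span B"
    by (rule fvec.basis_exists[of "Domain V"])
  have "\<forall>b\<in>B. \<exists>g. (b, g) \<in> V" using B(1) by blast
  then obtain G where G: "\<forall>b\<in>B. (b, G b) \<in> V" by metis
  obtain L where L: "Vector_Spaces.linear vscale vscale L" "\<And>b. b \<in> B \<Longrightarrow> L b = G b"
    using P.linear_independent_extend[OF B(2), of G] by blast
  interpret L: Vector_Spaces.linear vscale vscale L by (rule L(1))
  have "fvec.subspace {f. (f, L f) \<in> V}"
    using pvec.subspace_0[OF V(1)] pvec.subspace_add[OF V(1)] pvec.subspace_scale[OF V(1)]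
    by (fastforce simp: fvec.subspace_def L.add L.scale pscale_def zero_prod_def)
  moreover have "B \<subseteq> {f. (f, L f) \<in> V}" using G L(2) by auto
  ultimately have sub: "Domain V \<subseteq> {f. (f, L f) \<in> V}" using B(3) fvec.span_minimal by blast
  \<comment> \<open>Subtracting the known pair \<open>(f, L f)\<close> moves every other pair over \<open>f\<close> to one over 0.\<close>
  have iff: "(f, g) \<in> V \<longleftrightarrow> f \<in> Domain V \<and> (0, g - L f) \<in> V" for f g
  proof
    assume "(f, g) \<in> V"
    moreover from this have "(f, L f) \<in> V" using sub by blast
    ultimately have "(f, g) - (f, L f) \<in> V" by (rule pvec.subspace_diff[OF V(1)])
    then show "f \<in> Domain V \<and> (0, g - L f) \<in> V" using \<open>(f, g) \<in> V\<close> by auto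
  next
    assume h: "f \<in> Domain V \<and> (0, g - L f) \<in> V"
    then have "(f, L f) + (0, g - L f) \<in> V"
      using sub by (intro pvec.subspace_add[OF V(1)]) auto
    then show "(f, g) \<in> V" by simp
  qed
  show thesis
  proof (rule that[OF L(1)])
    show "V = coset_graph (Domain V) (contract_dot V) L"
    proof (intro set_eqI; clarify)
      fix f g
      show "(f, g) \<in> V \<longleftrightarrow> (f, g) \<in> coset_graph (Domain V) (contract_dot V) L"
        unfolding mem_coset_graph_iff_diff contract_dot_def mem_Collect_eq by (rule iff)
    qed
    show "L ` Domain V \<subseteq> Domain V" using sub V(2) by blast
    show "L ` contract_dot V \<subseteq> contract_dot V"
    proof clarify
      fix n assume "n \<in> contract_dot V"
      then have n: "(n, 0) \<in> V" using V(3) by (auto simp: contract_def)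
      then have "(n, L n) - (n, 0) \<in> V"
        using sub by (intro pvec.subspace_diff[OF V(1)]) auto
      then show "L n \<in> contract_dot V" by (simp add: contract_dot_def)
    qed
  qed
qed

lemma subspace_Domain:
  assumes "pvec.subspace V"
  shows "fvec.subspace (Domain V)"
  unfolding fvec.subspace_def
proof (intro conjI ballI allI)
  show "0 \<in> Domain V" using pvec.subspace_0[OF assms] by (auto simp: zero_prod_def)
next
  fix x y assume "x \<in> Domain V" "y \<in> Domain V"
  then obtain g h where "(x, g) \<in> V" "(y, h) \<in> V" by blast
  then have "(x, g) + (y, h) \<in> V" by (rule pvec.subspace_add[OF assms])
  then show "x + y \<in> Domain V" by auto
next
  fix c x assume "x \<in> Domain V"
  then obtain g where "(x, g) \<in> V" by blast
  then have "pscale c (x, g) \<in> V" by (rule pvec.subspace_scale[OF assms])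
  then show "vscale c x \<in> Domain V" by (auto simp: pscale_def)
qed

lemma subspace_contract_dot:
  assumes "pvec.subspace V"
  shows "fvec.subspace (contract_dot V)"
  using pvec.subspace_0[OF assms] pvec.subspace_add[OF assms] pvec.subspace_scale[OF assms]
  by (fastforce simp: fvec.subspace_def contract_dot_def pscale_def zero_prod_def)

text \<open>
  By definition the power with exponent 0 is the identity restricted to \<open>D\<close> with \<open>N\<close> added to its
  values. This is what the identity of \<open>D / N\<close> induces, so the formula also holds for \<open>k = 0\<close>.
\<close>

lemma gpow_coset_graph:
  fixes L :: "('w \<Rightarrow> 'a::field) \<Rightarrow> ('w \<Rightarrow> 'a)"
  assumes N: "fvec.subspace N" and D: "fvec.subspace D" "D \<subseteq> vecs W" and "N \<subseteq> D"
    and L: "Vector_Spaces.linear vscale vscale L" "L ` D \<subseteq> D" "L ` N \<subseteq> N"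
  shows "gpow W (coset_graph D N L) k = coset_graph D N (L ^^ k)"
proof -
  interpret L: Vector_Spaces.linear vscale vscale L by (rule L(1))
  show ?thesis
  proof (induction k rule: induct_nat_012)
    case 0
    have "Domain (coset_graph D N L) = D"
      using fvec.subspace_0[OF N] by (auto simp: coset_graph_def)
    moreover have "contract_dot (coset_graph D N L) = N"
      by (intro contract_dot_coset_graph fvec.subspace_0 D(1) L.zero)
    ultimately show ?case
      using D(2) by (fastforce simp: gadd_def coset_graph_def Id_on_iff)
  next
    case 1
    show ?case by (simp add: eta_contract_eq)
  next
    case (ge2 k)
    have "(L ^^ Suc k) ` D \<subseteq> D" using L(2) by (induction k) auto
    then have "coset_graph D N (L ^^ Suc k) O coset_graph D N L
        = coset_graph D N (\<lambda>f. L ((L ^^ Suc k) f))"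
      using assms L.add by (intro relcomp_coset_graph)
    then show ?case using ge2 by (simp add: comp_def)
  qed
qed

lemma gpoly_coset_graph:
  fixes L :: "('w \<Rightarrow> 'a::field) \<Rightarrow> ('w \<Rightarrow> 'a)"
  assumes N: "fvec.subspace N" and D: "fvec.subspace D" "D \<subseteq> vecs W" and "N \<subseteq> D"
    and L: "Vector_Spaces.linear vscale vscale L" "L ` D \<subseteq> D" "L ` N \<subseteq> N"
  shows "gpoly W (coset_graph D N L) p = coset_graph D N (poly_op L p)"
proof -
  have "gscale (coeff p i) (gpow W (coset_graph D N L) i)
      = coset_graph D N (\<lambda>f. vscale (coeff p i) ((L ^^ i) f))" for i
  proof -
    interpret Li: Vector_Spaces.linear vscale vscale "L ^^ i" by (rule linear_funpow[OF L(1)])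
    show ?thesis
      by (simp only: gpow_coset_graph[OF assms]
          gscale_coset_graph[where F = "L ^^ i", OF N fvec.subspace_0[OF D(1)] Li.zero])
  qed
  then show ?thesis by (simp only: gpoly_def gsum_coset_graph[OF N] poly_op_def[abs_def])
qed

theorem theorem50:
  fixes W :: "'w set" and V :: "(('w \<Rightarrow> 'a::field) \<times> ('w \<Rightarrow> 'a)) set"
  assumes "finite W" and "genop W V"
  shows "(\<forall>p p1 q :: 'a poly. p = p1 * q \<longrightarrow>
            gpoly W V p = gpoly W V p1 *\<^sub>w gpoly W V q)
       \<and> (\<forall>p p1 q a :: 'a poly. p = p1 * q + a \<longrightarrow>
            gpoly W V p = (gpoly W V p1 *\<^sub>w gpoly W V q) +\<^sub>w gpoly W V a)
       \<and> (Domain V \<noteq> contract_dot V \<longrightarrow>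
            (\<exists>p. is_arg_min degree (\<lambda>r. degree r \<ge> 1 \<and> annihilates W V r) p \<and>
              (\<forall>q. is_arg_min degree (\<lambda>r. degree r \<ge> 1 \<and> annihilates W V r) q \<longleftrightarrow>
                   (\<exists>c. c \<noteq> 0 \<and> q = smult c p))))
       \<and> (\<exists>p. is_arg_min degree (\<lambda>r. r \<noteq> 0 \<and> annihilates W V r) p \<and>
            (\<forall>q. is_arg_min degree (\<lambda>r. r \<noteq> 0 \<and> annihilates W V r) q \<longleftrightarrow>
                 (\<exists>c. c \<noteq> 0 \<and> q = smult c p)))"
proof -
  define D N where "D = Domain V" and "N = contract_dot V"
  have V: "pvec.subspace V" "V \<subseteq> vecs W \<times> vecs W" "N \<subseteq> D"
    using \<open>genop W V\<close>
    by (auto simp: genop_def genaut_def D_def N_def contract_def contract_dot_def subset_iff)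
  have N: "fvec.subspace N" and D: "fvec.subspace D" "D \<subseteq> vecs W"
    using subspace_contract_dot subspace_Domain V(1,2) by (auto simp: D_def N_def)
  obtain L where L: "Vector_Spaces.linear vscale vscale L" "V = coset_graph D N L"
    "L ` D \<subseteq> D" "L ` N \<subseteq> N"
    unfolding D_def N_def by (rule genop_eq_coset_graph[OF \<open>genop W V\<close>])
  have gpoly: "gpoly W V p = coset_graph D N (poly_op L p)" for p
    unfolding L(2) by (rule gpoly_coset_graph[OF N D V(3) L(1,3,4)])
  have mult: "gpoly W V (p * q) = gpoly W V p *\<^sub>w gpoly W V q" for p q
  proof -
    interpret Q: Vector_Spaces.linear vscale vscale "poly_op L q" by (rule linear_poly_op[OF L(1)])
    show ?thesis
      unfolding gpoly poly_op_mult[OF L(1), abs_def]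
      by (intro relcomp_coset_graph[symmetric] N D V(3) poly_op_image_subset L(3,4) Q.add)
  qed
  have add: "gpoly W V (p + q) = gpoly W V p +\<^sub>w gpoly W V q" for p q
    by (simp only: gpoly gadd_coset_graph[OF N] poly_op_add[abs_def])
  have annih: "annihilates W V p \<longleftrightarrow> poly_op L p ` D \<subseteq> N" for p
  proof -
    interpret P: Vector_Spaces.linear vscale vscale "poly_op L p" by (rule linear_poly_op[OF L(1)])
    show ?thesis
      unfolding annihilates_def gpoly using V(3) D N P.zero
      by (intro decoupled_coset_graph) auto
  qed
  let ?I = "{p. annihilates W V p}"
  have min: "\<exists>p. is_arg_min degree (\<lambda>r. r \<noteq> 0 \<and> r \<in> ?I) p \<and>
    (\<forall>q. is_arg_min degree (\<lambda>r. r \<noteq> 0 \<and> r \<in> ?I) q \<longleftrightarrow> (\<exists>c. c \<noteq> 0 \<and> q = smult c p))"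
  proof (rule min_degree_unique_up_to_scalar)
    show "p - q \<in> ?I" if "p \<in> ?I" "q \<in> ?I" for p q
      using that fvec.subspace_diff[OF N] by (auto simp: annih poly_op_diff image_subset_iff)
    show "smult c p \<in> ?I" if "p \<in> ?I" for c p
      using that fvec.subspace_scale[OF N] by (auto simp: annih poly_op_smult image_subset_iff)
    obtain p where "p \<noteq> 0" "\<forall>f\<in>D. poly_op L p f = 0"
      using ex_annihilator_on_subspace[OF \<open>finite W\<close> L(1) D(2) L(3)] by blast
    then show "\<exists>p\<in>?I. p \<noteq> 0"
      using fvec.subspace_0[OF N] by (auto simp: annih image_subset_iff intro!: exI[of _ p])
  qed
  have degree_ge_1: "degree r \<ge> 1" if "D \<noteq> N" "annihilates W V r" "r \<noteq> 0" for r
  proof (rule ccontr)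
    assume "\<not> degree r \<ge> 1"
    then have "degree r = 0" by simp
    then obtain c where c: "r = [:c:]" by (rule degree_eq_zeroE)
    have "f \<in> N" if "f \<in> D" for f
    proof -
      have "vscale c f \<in> N" using \<open>annihilates W V r\<close> that by (auto simp: annih c)
      then have "vscale (inverse c) (vscale c f) \<in> N" by (rule fvec.subspace_scale[OF N])
      then show ?thesis using \<open>r \<noteq> 0\<close> c by simp
    qed
    then show False using V(3) \<open>D \<noteq> N\<close> by blast
  qed
  have degree_condition: "(\<lambda>r. degree r \<ge> 1 \<and> annihilates W V r) = (\<lambda>r. r \<noteq> 0 \<and> annihilates W V r)"
    if "D \<noteq> N"
    using degree_ge_1[OF that] by (auto simp: fun_eq_iff)
  show ?thesis
  proof (intro conjI allI impI)
    show "gpoly W V p = gpoly W V p1 *\<^sub>w gpoly W V q" if "p = p1 * q" for p p1 q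
      unfolding that by (rule mult)
    show "gpoly W V p = (gpoly W V p1 *\<^sub>w gpoly W V q) +\<^sub>w gpoly W V a"
      if "p = p1 * q + a" for p p1 q a
      unfolding that add mult by (rule refl)
  next
    assume "Domain V \<noteq> contract_dot V"
    then have "D \<noteq> N" by (simp only: D_def N_def not_False_eq_True)
    show "\<exists>p. is_arg_min degree (\<lambda>r. degree r \<ge> 1 \<and> annihilates W V r) p \<and>
        (\<forall>q. is_arg_min degree (\<lambda>r. degree r \<ge> 1 \<and> annihilates W V r) q \<longleftrightarrow>
          (\<exists>c. c \<noteq> 0 \<and> q = smult c p))"
      unfolding degree_condition[OF \<open>D \<noteq> N\<close>] using min by (simp only: mem_Collect_eq)
  next
    show "\<exists>p. is_arg_min degree (\<lambda>r. r \<noteq> 0 \<and> annihilates W V r) p \<and>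
        (\<forall>q. is_arg_min degree (\<lambda>r. r \<noteq> 0 \<and> annihilates W V r) q \<longleftrightarrow>
          (\<exists>c. c \<noteq> 0 \<and> q = smult c p))"
      using min by (simp only: mem_Collect_eq)
  qed
qed

end
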